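(* Let $\mathcal{Z}$ be a nonempty countable set (finite or countably infinite) with the discrete $\sigma$-algebra, let $(\mathcal{B},\mathscr{H})$ be a measurable space, let $L\in[0,\infty)$, and let $\ell:\mathcal{B}\times\mathcal{Z}\to[0,L]$ be a measurable loss function such that for every probability measure $\mu$ on $\mathcal{Z}$ the map $b\mapsto\int\ell(b,z)\,\mu(dz)$ attains its minimum on $\mathcal{B}$. Then there is a policy $(b_t)_{t\in\mathbb{N}}$, $b_t:\mathcal{Z}^{t-1}\to\mathcal{B}$, which is universal for all computable probability distributions in the following sense: for every computable probability distribution $P$ on $\mathcal{Z}^{\mathbb{N}}$ there is a constant $C\in(0,\infty)$ (depending on $P$ and $L$, but not on $T$ or $\delta$) such that for every $T\in\mathbb{N}$ and every $\delta\in(0,1)$, $$P\left(\Delta<\frac{C}{\sqrt{T\delta}}\right)\geq1-\delta,$$ where $\Delta$ is the average per-round regret up to time $T$ of the policy $(b_t)$ relative to a $P$-optimal policy, as defined in the context.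
   Context: Computability: fix an identification of $\mathcal{Z}$ with $\mathbb{N}$ or with $\{1,\dots,k\}$ for some $k$. A probability distribution $P$ on $\mathcal{Z}^{\mathbb{N}}$ (with the product $\sigma$-algebra) is computable if there is a program on a universal Turing machine that computes it to arbitrary precision, i.e. a program that, given a finite tuple $(z_1,\dots,z_t)$ of elements of $\mathcal{Z}$ and $n\in\mathbb{N}$, outputs a rational number within $2^{-n}$ of $P(Z_1=z_1,\dots,Z_t=z_t)$, where $Z_1,Z_2,\dots$ are the coordinate variables. $P$-optimal policy: functions $b_t^*:\mathcal{Z}^{t-1}\to\mathcal{B}$, $t\in\mathbb{N}$ (for $t=1$ the argument is the empty tuple), such that for every $t$ and all $z_1,\dots,z_{t-1}\in\mathcal{Z}$ $$b_t^*(z_1,\dots,z_{t-1})\in\operatorname*{arg\,min}_{b\in\mathcal{B}}\mathbb{E}_P\big(\ell(b,Z_t)\mid Z_1=z_1,\dots,Z_{t-1}=z_{t-1}\big),$$ where the conditional expectation is taken with respect to a fixed version of the conditional distribution of $Z_t$ given $(Z_1,\dots,Z_{t-1})$ under $P$. Regret: for a time horizon $T\in\mathbb{N}$ and $(Z_1,Z_2,\dots)\sim P$, $$\Delta:=\frac1T\sum_{t=1}^T\big(\ell(b_t(Z_1,\dots,Z_{t-1}),Z_t)-\ell(b_t^*(Z_1,\dots,Z_{t-1}),Z_t)\big).$$ *)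

theory Defs
  imports "HOL-Probability.Probability"
begin

section \<open>Turing machines\<close>

text \<open>Deterministic machines with one two-sided infinite tape.  A program is a finite
  transition table; the first entry that applies is used, and the machine halts when none
  does.  The finitely many states and working symbols of a program are drawn from infinite
  stocks.  Running a universal machine on a program is modelled by
  \<open>tm_step\<close> with that program as argument.\<close>

datatype tm_symbol = Blank | Mark | Sep | Minus | Work nat

datatype tm_move = Move_Left | Move_Stay | Move_Right

type_synonym tm_program = "((nat \<times> tm_symbol) \<times> (nat \<times> tm_symbol \<times> tm_move)) list"

text \<open>State, head position, tape content.\<close>

type_synonym tm_config = "nat \<times> int \<times> (int \<Rightarrow> tm_symbol)"

fun tm_offset :: "tm_move \<Rightarrow> int" where
  "tm_offset Move_Left = -1"
| "tm_offset Move_Stay = 0"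
| "tm_offset Move_Right = 1"

inductive tm_step :: "tm_program \<Rightarrow> tm_config \<Rightarrow> tm_config \<Rightarrow> bool" for p where
  "map_of p (q, tape h) = Some (q', a, m) \<Longrightarrow>
    tm_step p (q, h, tape) (q', h + tm_offset m, tape(h := a))"

definition tm_init :: "tm_symbol list \<Rightarrow> tm_config" where
  "tm_init w = (0, 0, \<lambda>i. if 0 \<le> i \<and> i < int (length w) then w ! nat i else Blank)"

text \<open>The output is read off the final tape, from the head rightwards up to the first
  blank.\<close>

definition tm_outputs :: "tm_program \<Rightarrow> tm_symbol list \<Rightarrow> tm_symbol list \<Rightarrow> bool" where
  "tm_outputs p w v \<longleftrightarrow> (\<exists>q h tape.
     (tm_step p)\<^sup>*\<^sup>* (tm_init w) (q, h, tape) \<and>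
     map_of p (q, tape h) = None \<and>
     Blank \<notin> set v \<and>
     (\<forall>i < length v. tape (h + int i) = v ! i) \<and>
     tape (h + int (length v)) = Blank)"

definition encode_nats :: "nat list \<Rightarrow> tm_symbol list" where
  "encode_nats ns = concat (map (\<lambda>n. replicate n Mark @ [Sep]) ns)"

definition encode_rat :: "rat \<Rightarrow> tm_symbol list" where
  "encode_rat r = (case quotient_of r of (a, c) \<Rightarrow>
     (if a < 0 then [Minus] else []) @ encode_nats [nat \<bar>a\<bar>, nat c])"


section \<open>Computable distributions on sequences\<close>

text \<open>Sequences are indexed from 0, so the coordinate variable \<open>Z\<^sub>t\<close> with \<open>t \<ge> 1\<close> is
  \<open>\<lambda>\<omega>. \<omega> (t - 1)\<close>, and a tuple in \<open>\<Z>\<^sup>t\<close> is a list of length \<open>t\<close>.\<close>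

definition identification :: "('z \<Rightarrow> nat) \<Rightarrow> bool" where
  "identification e \<longleftrightarrow> bij_betw e UNIV {1..} \<or> (\<exists>k. bij_betw e UNIV {1..k})"

definition history :: "nat \<Rightarrow> (nat \<Rightarrow> 'z) \<Rightarrow> 'z list" where
  "history t \<omega> = map \<omega> [0..<t]"

abbreviation seq_space :: "(nat \<Rightarrow> 'z) measure" where
  "seq_space \<equiv> PiM UNIV (\<lambda>_. count_space UNIV)"

definition computable_distribution :: "('z \<Rightarrow> nat) \<Rightarrow> (nat \<Rightarrow> 'z) measure \<Rightarrow> bool" where
  "computable_distribution e P \<longleftrightarrow>
     P \<in> space (prob_algebra seq_space) \<and>
     (\<exists>p. \<forall>zs n. \<exists>r.
        tm_outputs p (encode_nats (map e zs @ [n])) (encode_rat r) \<and>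
        \<bar>real_of_rat r - measure P {\<omega> \<in> space P. history (length zs) \<omega> = zs}\<bar> \<le> 1 / 2 ^ n)"


section \<open>Loss functions, policies and regret\<close>

text \<open>The decision space is \<open>space H\<close>.\<close>

definition loss_function :: "'b measure \<Rightarrow> real \<Rightarrow> ('b \<Rightarrow> 'z \<Rightarrow> real) \<Rightarrow> bool" where
  "loss_function H L loss \<longleftrightarrow>
     (\<lambda>(b, z). loss b z) \<in> borel_measurable (H \<Otimes>\<^sub>M count_space UNIV) \<and>
     (\<forall>b \<in> space H. \<forall>z. loss b z \<in> {0..L})"

definition expected_loss :: "('b \<Rightarrow> 'z \<Rightarrow> real) \<Rightarrow> 'z measure \<Rightarrow> 'b \<Rightarrow> real" where
  "expected_loss loss \<mu> b = (\<integral>z. loss b z \<partial>\<mu>)"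

definition minimum_attained :: "'b measure \<Rightarrow> ('b \<Rightarrow> 'z \<Rightarrow> real) \<Rightarrow> bool" where
  "minimum_attained H loss \<longleftrightarrow>
     (\<forall>\<mu> \<in> space (prob_algebra (count_space UNIV)).
        \<exists>b. is_arg_min (expected_loss loss \<mu>) (\<lambda>b. b \<in> space H) b)"

text \<open>A family of functions of the histories of all lengths, such as the decisions
  \<open>b\<^sub>t\<close> on \<open>\<Z>\<^sup>t\<^sup>-\<^sup>1\<close> for all \<open>t \<ge> 1\<close>, is a single function on lists: \<open>b\<^sub>t\<close> is its
  restriction to the lists of length \<open>t - 1\<close>.\<close>

definition policy :: "'b measure \<Rightarrow> ('z list \<Rightarrow> 'b) \<Rightarrow> bool" where
  "policy H b \<longleftrightarrow> (\<forall>zs. b zs \<in> space H)"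

text \<open>\<open>\<kappa>\<close>, restricted to lists of length \<open>t\<close>, is a version of the conditional distribution of
  coordinate \<open>t\<close> (i.e. \<open>Z\<^sub>t\<^sub>+\<^sub>1\<close>) given the first \<open>t\<close> coordinates.  Its values are unconstrained
  on histories of probability zero.\<close>

definition conditional_distribution ::
    "(nat \<Rightarrow> 'z) measure \<Rightarrow> ('z list \<Rightarrow> 'z measure) \<Rightarrow> bool" where
  "conditional_distribution P \<kappa> \<longleftrightarrow>
     \<kappa> \<in> count_space UNIV \<rightarrow>\<^sub>M prob_algebra (count_space UNIV) \<and>
     (\<forall>t A. AE \<omega> in P. measure (\<kappa> (history t \<omega>)) A =
        real_cond_exp P (vimage_algebra (space P) (history t) (count_space UNIV))
          (\<lambda>\<omega>. indicator A (\<omega> t)) \<omega>)"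

definition optimal_policy ::
    "'b measure \<Rightarrow> ('b \<Rightarrow> 'z \<Rightarrow> real) \<Rightarrow> ('z list \<Rightarrow> 'z measure) \<Rightarrow> ('z list \<Rightarrow> 'b) \<Rightarrow> bool" where
  "optimal_policy H loss \<kappa> b \<longleftrightarrow>
     (\<forall>zs. is_arg_min (expected_loss loss (\<kappa> zs)) (\<lambda>b. b \<in> space H) (b zs))"

definition regret ::
    "('b \<Rightarrow> 'z \<Rightarrow> real) \<Rightarrow> ('z list \<Rightarrow> 'b) \<Rightarrow> ('z list \<Rightarrow> 'b) \<Rightarrow> nat \<Rightarrow> (nat \<Rightarrow> 'z) \<Rightarrow> real" where
  "regret loss b b' T \<omega> = 1 / real T *
     (\<Sum>t<T. loss (b (history t \<omega>)) (\<omega> t) - loss (b' (history t \<omega>)) (\<omega> t))"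

end

theory Submission
  imports Defs
begin

text \<open>A program determines at most one family of cylinder probabilities, so some mixture \<open>U\<close> of
  countably many distributions satisfies \<open>w * P \<le> U\<close> on cylinders for every computable \<open>P\<close>, with a
  weight \<open>w > 0\<close> that depends on \<open>P\<close>.  The universal policy minimises the expected loss under the
  predictions of \<open>U\<close>.

  Split the total regret after \<open>T\<close> rounds into a \<open>P\<close>-martingale with increments of variance at
  most \<open>L\<^sup>2\<close> and the sum of the conditional expected regrets \<open>x\<^sub>t \<ge> 0\<close>.  As \<open>U\<close>'s decision is
  optimal for \<open>U\<close>'s prediction, \<open>x\<^sub>t\<^sup>2\<close> is at most \<open>4 * L\<^sup>2\<close> times the squared Hellinger distance
  between the predictions of \<open>P\<close> and \<open>U\<close>, and hence at most \<open>4 * L\<^sup>2\<close> times their relative entropy.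
  So the sum of the \<open>x\<^sub>t\<^sup>2\<close> plus \<open>4 * L\<^sup>2 * ln (U / (w * P))\<close> is a nonnegative supermartingale that
  starts at \<open>4 * L\<^sup>2 * ln (1 / w)\<close>.  By Cauchy-Schwarz, the second moment of the total regret is at
  most \<open>2 * T * L\<^sup>2 * (1 + 4 * ln (1 / w))\<close>, and Markov's inequality for the square concludes.\<close>

section \<open>Uniqueness of the distribution computed by a program\<close>

instance tm_symbol :: countable by countable_datatype
instance tm_move :: countable by countable_datatype

section \<open>Determinism of runs and uniqueness of outputs\<close>

lemma tm_step_deterministic: "tm_step p c c' \<Longrightarrow> tm_step p c c'' \<Longrightarrow> c' = c''"
  by (auto elim!: tm_step.cases)

lemma tm_step_halted: "map_of p (q, tape h) = None \<Longrightarrow> \<not> tm_step p (q, h, tape) c"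
  by (auto elim!: tm_step.cases)

text \<open>Induction along the first run: determinism forces both runs to make the same steps, and
  a halted configuration has no successor.\<close>

lemma tm_halting_config_unique:
  assumes "(tm_step p)\<^sup>*\<^sup>* c d" "(tm_step p)\<^sup>*\<^sup>* c d'"
    and "\<And>x. \<not> tm_step p d x" "\<And>x. \<not> tm_step p d' x"
  shows "d = d'"
  using assms(1,2)
proof (induction rule: converse_rtranclp_induct)
  case base
  then show ?case by (cases rule: converse_rtranclpE) (use assms(3) in auto)
next
  case (step y z)
  from step.prems show ?case
  proof (cases rule: converse_rtranclpE)
    case base
    then show ?thesis using step.hyps(1) assms(4) by blast
  next
    case (step z')
    then show ?thesis using tm_step_deterministic[OF \<open>tm_step p y z\<close>] \<open>(tm_step p)\<^sup>*\<^sup>* z d' \<Longrightarrow> d = d'\<close> by blast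
  qed
qed

text \<open>If one word were shorter, its terminating blank would be a letter of the other.\<close>

lemma blank_terminated_unique:
  assumes "Blank \<notin> set v" "\<And>i. i < length v \<Longrightarrow> f i = v ! i" "f (length v) = Blank"
    and "Blank \<notin> set v'" "\<And>i. i < length v' \<Longrightarrow> f i = v' ! i" "f (length v') = Blank"
  shows "v = v'"
proof -
  have "\<not> length v < length v'"
  proof
    assume "length v < length v'"
    then show False using assms(4) assms(5)[of "length v"] assms(3) nth_mem[of "length v" v'] by simp
  qed
  moreover have "\<not> length v' < length v"
  proof
    assume "length v' < length v"
    then show False using assms(1) assms(2)[of "length v'"] assms(6) nth_mem[of "length v'" v] by simp
  qed
  ultimately have "length v = length v'" by simp
  then show ?thesis using assms(2,5) by (intro nth_equalityI) simp_all
qed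

lemma tm_outputs_unique:
  assumes "tm_outputs p w v" "tm_outputs p w v'"
  shows "v = v'"
proof -
  obtain q h tape where 1: "(tm_step p)\<^sup>*\<^sup>* (tm_init w) (q, h, tape)" "map_of p (q, tape h) = None"
     "Blank \<notin> set v" "\<forall>i < length v. tape (h + int i) = v ! i"
     "tape (h + int (length v)) = Blank"
    using assms(1) unfolding tm_outputs_def by (elim exE conjE) rule
  obtain q' h' tape' where 2: "(tm_step p)\<^sup>*\<^sup>* (tm_init w) (q', h', tape')"
     "map_of p (q', tape' h') = None"
     "Blank \<notin> set v'" "\<forall>i < length v'. tape' (h' + int i) = v' ! i"
     "tape' (h' + int (length v')) = Blank"
    using assms(2) unfolding tm_outputs_def by (elim exE conjE) rule
  have "(q, h, tape) = (q', h', tape')"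
    using tm_halting_config_unique[OF 1(1) 2(1)] tm_step_halted[of p q tape h, OF 1(2)]
      tm_step_halted[of p q' tape' h', OF 2(2)] by simp
  then show ?thesis
    using blank_terminated_unique[of v "\<lambda>i. tape (h + int i)" v'] 1(3-) 2(3-) by simp
qed

section \<open>Unique decoding of rationals\<close>

lemma replicate_sep_cancel:
  "replicate m Mark @ Sep # xs = replicate n Mark @ Sep # ys \<longleftrightarrow> m = n \<and> xs = ys"
proof (induction m arbitrary: n)
  case 0
  then show ?case by (cases n) auto
next
  case (Suc m)
  then show ?case by (cases n) auto
qed

lemma encode_nats_pair_cancel: "encode_nats [a, b] = encode_nats [a', b'] \<longleftrightarrow> a = a' \<and> b = b'"
  by (simp add: encode_nats_def replicate_sep_cancel)

lemma Minus_notin_encode_nats: "Minus \<notin> set (encode_nats ns)"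
  by (induction ns) (auto simp: encode_nats_def)

text \<open>\<open>Minus\<close> reveals the sign, and the unary blocks closed by \<open>Sep\<close>
  reveal the absolute numerator and the denominator. The denominator is positive, so passing to
  \<open>nat\<close> loses nothing.\<close>

lemma inj_encode_rat: "inj encode_rat"
proof (rule injI)
  fix r r' :: rat
  assume eq: "encode_rat r = encode_rat r'"
  obtain a c where q: "quotient_of r = (a, c)" by fastforce
  obtain a' c' where q': "quotient_of r' = (a', c')" by fastforce
  have pos: "c > 0" "c' > 0" using quotient_of_denom_pos q q' by blast+
  have "Minus \<in> set (encode_rat r) \<longleftrightarrow> a < 0" "Minus \<in> set (encode_rat r') \<longleftrightarrow> a' < 0"
    using Minus_notin_encode_nats by (auto simp: encode_rat_def q q')
  then have "a < 0 \<longleftrightarrow> a' < 0" using eq by simp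
  then have "encode_nats [nat \<bar>a\<bar>, nat c] = encode_nats [nat \<bar>a'\<bar>, nat c']"
    using eq by (auto simp: encode_rat_def q q' split: if_splits)
  then have "a = a'" "c = c'"
    using pos \<open>a < 0 \<longleftrightarrow> a' < 0\<close> unfolding encode_nats_pair_cancel by auto
  then show "r = r'" using q q' by (metis quotient_of_inject)
qed

section \<open>Cylinder probabilities determined by a program\<close>

definition cylinder_prob :: "(nat \<Rightarrow> 'z) measure \<Rightarrow> 'z list \<Rightarrow> real" where
  "cylinder_prob P zs = measure P {\<omega> \<in> space P. history (length zs) \<omega> = zs}"

definition computes_cylinders ::
    "('z \<Rightarrow> nat) \<Rightarrow> tm_program \<Rightarrow> (nat \<Rightarrow> 'z) measure \<Rightarrow> bool" where
  "computes_cylinders e p P \<longleftrightarrow> (\<forall>zs n. \<exists>r.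
     tm_outputs p (encode_nats (map e zs @ [n])) (encode_rat r) \<and>
     \<bar>real_of_rat r - cylinder_prob P zs\<bar> \<le> 1 / 2 ^ n)"

lemma computable_distribution_alt:
  "computable_distribution e P \<longleftrightarrow>
     P \<in> space (prob_algebra seq_space) \<and> (\<exists>p. computes_cylinders e p P)"
  by (simp add: computable_distribution_def computes_cylinders_def cylinder_prob_def)

text \<open>Outputs are unique, so at each precision \<open>n\<close> the same rational approximates
  both probabilities.\<close>

lemma computes_cylinders_unique:
  assumes "computes_cylinders e p P" "computes_cylinders e p P'"
  shows "cylinder_prob P zs = cylinder_prob P' zs"
proof -
  have "\<bar>cylinder_prob P zs - cylinder_prob P' zs\<bar> \<le> 2 * (1 / 2) ^ n" for n
  proof -
    obtain r where r: "tm_outputs p (encode_nats (map e zs @ [n])) (encode_rat r)"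
      "\<bar>real_of_rat r - cylinder_prob P zs\<bar> \<le> 1 / 2 ^ n"
      using assms(1) unfolding computes_cylinders_def by blast
    obtain r' where r': "tm_outputs p (encode_nats (map e zs @ [n])) (encode_rat r')"
      "\<bar>real_of_rat r' - cylinder_prob P' zs\<bar> \<le> 1 / 2 ^ n"
      using assms(2) unfolding computes_cylinders_def by blast
    have "r = r'" by (rule injD[OF inj_encode_rat tm_outputs_unique[OF r(1) r'(1)]])
    then show ?thesis using r(2) r'(2) by (simp add: power_one_over)
  qed
  moreover have lim: "(\<lambda>n. 2 * (1 / 2) ^ n :: real) \<longlonglongrightarrow> 2 * 0"
    by (intro tendsto_mult tendsto_const LIMSEQ_power_zero) auto
  ultimately have "\<bar>cylinder_prob P zs - cylinder_prob P' zs\<bar> \<le> 0"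
    using LIMSEQ_le_const[OF lim] by fastforce
  then show ?thesis by simp
qed

section \<open>Hellinger distance and relative entropy\<close>

text \<open>The integral of \<open>(t * u x - v x)\<^sup>2\<close> is a quadratic polynomial in
  \<open>t\<close> that is never negative; its value at \<open>t = B / A\<close> gives the
  inequality.\<close>

lemma Cauchy_Schwarz_integral:
  fixes u v :: "'a \<Rightarrow> real"
  assumes "integrable M (\<lambda>x. (u x)\<^sup>2)" "integrable M (\<lambda>x. u x * v x)" "integrable M (\<lambda>x. (v x)\<^sup>2)"
  shows "(\<integral>x. u x * v x \<partial>M)\<^sup>2 \<le> (\<integral>x. (u x)\<^sup>2 \<partial>M) * (\<integral>x. (v x)\<^sup>2 \<partial>M)"
proof -
  define A B D where "A = (\<integral>x. (u x)\<^sup>2 \<partial>M)" and "B = (\<integral>x. u x * v x \<partial>M)"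
    and "D = (\<integral>x. (v x)\<^sup>2 \<partial>M)"
  have nonneg: "0 \<le> t\<^sup>2 * A - 2 * t * B + D" for t
  proof -
    have "0 \<le> (\<integral>x. (t * u x - v x)\<^sup>2 \<partial>M)" by simp
    also have "(\<lambda>x. (t * u x - v x)\<^sup>2) = (\<lambda>x. t\<^sup>2 * (u x)\<^sup>2 - 2 * t * (u x * v x) + (v x)\<^sup>2)"
      by (simp add: power2_eq_square algebra_simps)
    also have "(\<integral>x. t\<^sup>2 * (u x)\<^sup>2 - 2 * t * (u x * v x) + (v x)\<^sup>2 \<partial>M) = t\<^sup>2 * A - 2 * t * B + D"
      using assms by (simp add: A_def B_def D_def)
    finally show ?thesis .
  qed
  have "A \<ge> 0" by (simp add: A_def)
  have "B\<^sup>2 \<le> A * D"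
  proof (cases "A = 0")
    case True
    have "B = 0"
    proof (rule ccontr)
      assume "B \<noteq> 0"
      \<comment> \<open>With \<open>A = 0\<close> the polynomial is linear, and at this point it
        equals \<open>D - (D + 1) = -1\<close>.\<close>
      then show False using nonneg[of "(D + 1) / (2 * B)"] True by simp
    qed
    then show ?thesis using True by simp
  next
    case False
    then have "A > 0" using \<open>A \<ge> 0\<close> by simp
    then show ?thesis using nonneg[of "B / A"] by (simp add: field_simps power2_eq_square)
  qed
  then show ?thesis by (simp add: A_def B_def D_def)
qed

section \<open>Density of one pmf with respect to another\<close>

lemma measure_pmf_density_ratio:
  assumes "set_pmf k \<subseteq> set_pmf q"
  shows "measure_pmf k = density (measure_pmf q) (\<lambda>z. ennreal (pmf k z / pmf q z))"
proof -
  have "ennreal (pmf q z) * ennreal (pmf k z / pmf q z) = ennreal (pmf k z)" for z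
    using assms by (cases "pmf q z = 0") (auto simp: set_pmf_iff ennreal_mult[symmetric])
  then show ?thesis
    unfolding measure_pmf_eq_density by (subst density_density_eq) auto
qed

lemma
  fixes g :: "'a \<Rightarrow> real"
  assumes "set_pmf k \<subseteq> set_pmf q"
  shows integral_pmf_ratio: "(\<integral>z. g z \<partial>k) = (\<integral>z. pmf k z / pmf q z * g z \<partial>q)"
    and integrable_pmf_ratio: "integrable k g \<longleftrightarrow> integrable q (\<lambda>z. pmf k z / pmf q z * g z)"
  by (simp_all add: measure_pmf_density_ratio[OF assms] integral_density integrable_density)

text \<open>The claims about the root follow from \<open>sqrt x \<le> (1 + x) / 2\<close>. The bound
  by 1 later makes the Hellinger distance nonnegative.\<close>

lemma pmf_ratio_facts:
  fixes k q :: "'a pmf"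
  assumes "set_pmf k \<subseteq> set_pmf q"
  shows integrable_ratio: "integrable q (\<lambda>z. pmf k z / pmf q z)"
    and integral_ratio: "(\<integral>z. pmf k z / pmf q z \<partial>q) = 1"
    and integrable_sqrt_ratio: "integrable q (\<lambda>z. sqrt (pmf k z / pmf q z))"
    and integral_sqrt_ratio_le_1: "(\<integral>z. sqrt (pmf k z / pmf q z) \<partial>q) \<le> 1"
proof -
  show 1: "integrable q (\<lambda>z. pmf k z / pmf q z)"
    using integrable_pmf_ratio[OF assms, of "\<lambda>_. 1"] by simp
  show 2: "(\<integral>z. pmf k z / pmf q z \<partial>q) = 1"
    using integral_pmf_ratio[OF assms, of "\<lambda>_. 1"] by simp
  have le: "sqrt x \<le> (1 + x) / 2" if "x \<ge> 0" for x :: real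
    using arith_geo_mean_sqrt[of 1 x] that by simp
  show 3: "integrable q (\<lambda>z. sqrt (pmf k z / pmf q z))"
    by (rule Bochner_Integration.integrable_bound[of _ "\<lambda>z. (1 + pmf k z / pmf q z) / 2"])
      (use 1 le in auto)
  have "(\<integral>z. sqrt (pmf k z / pmf q z) \<partial>q) \<le> (\<integral>z. (1 + pmf k z / pmf q z) / 2 \<partial>q)"
    by (rule integral_mono) (use 1 3 le in auto)
  also have "\<dots> = 1" using 1 2 by simp
  finally show "(\<integral>z. sqrt (pmf k z / pmf q z) \<partial>q) \<le> 1" .
qed

text \<open>When \<open>set_pmf k \<subseteq> set_pmf q\<close>, this is the sum of \<open>(sqrt (pmf k z) - sqrt (pmf q z))\<^sup>2\<close>;
  mass of \<open>k\<close> outside the support of \<open>q\<close> is lost because \<open>x / 0 = 0\<close>.\<close>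

definition hellinger :: "'a pmf \<Rightarrow> 'a pmf \<Rightarrow> real" where
  "hellinger k q = 2 - 2 * (\<integral>z. sqrt (pmf k z / pmf q z) \<partial>q)"

text \<open>Cauchy-Schwarz applied to \<open>r - 1 = (sqrt r - 1) * (sqrt r + 1)\<close> for the density
  \<open>r = k / q\<close>.\<close>

lemma expectation_diff_le_hellinger:
  fixes f :: "'a \<Rightarrow> real"
  assumes sub: "set_pmf k \<subseteq> set_pmf q" and f: "\<And>z. \<bar>f z\<bar> \<le> L"
  shows "((\<integral>z. f z \<partial>k) - (\<integral>z. f z \<partial>q))\<^sup>2 \<le> 4 * L\<^sup>2 * hellinger k q"
proof -
  define r where "r z = pmf k z / pmf q z" for z
  have r: "r z \<ge> 0" "sqrt (r z) * sqrt (r z) = r z" for z by (auto simp: r_def)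
  note facts = pmf_ratio_facts[OF sub, folded r_def]
  have intf: "integrable p f" for p :: "'a pmf"
    by (rule measure_pmf.integrable_const_bound[of _ L]) (use f in auto)
  have intrf: "integrable q (\<lambda>z. r z * f z)"
    using intf[of k] integrable_pmf_ratio[OF sub, of f] by (simp add: r_def)
  \<comment> \<open>On expanding the squares, \<open>r\<close> has integral 1 and
    \<open>sqrt r\<close> at most 1, so the first integral is at most
    \<open>1 + 2 + 1 = 4\<close>.\<close>
  have intp: "integrable q (\<lambda>z. (sqrt (r z) + 1)\<^sup>2)" "(\<integral>z. (sqrt (r z) + 1)\<^sup>2 \<partial>q) \<le> 4"
    and intm: "integrable q (\<lambda>z. (sqrt (r z) - 1)\<^sup>2)"
      "(\<integral>z. (sqrt (r z) - 1)\<^sup>2 \<partial>q) = hellinger k q"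
    using facts by (simp_all add: power2_eq_square algebra_simps r hellinger_def flip: r_def)
  have "(f z)\<^sup>2 \<le> L\<^sup>2" for z using f[of z] by (metis abs_ge_zero power2_abs power_mono)
  then have le: "((sqrt (r z) + 1) * f z)\<^sup>2 \<le> L\<^sup>2 * (sqrt (r z) + 1)\<^sup>2" for z
    by (simp add: power_mult_distrib mult.commute mult_right_mono)
  have intpf: "integrable q (\<lambda>z. ((sqrt (r z) + 1) * f z)\<^sup>2)"
    by (rule Bochner_Integration.integrable_bound[of _ "\<lambda>z. L\<^sup>2 * (sqrt (r z) + 1)\<^sup>2"])
      (use intp le in auto)
  have eq: "(sqrt (r z) - 1) * ((sqrt (r z) + 1) * f z) = r z * f z - f z" for z
    by (simp add: algebra_simps r flip: mult.assoc)
  have "(\<integral>z. f z \<partial>k) - (\<integral>z. f z \<partial>q) = (\<integral>z. (sqrt (r z) - 1) * ((sqrt (r z) + 1) * f z) \<partial>q)"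
    unfolding eq using intf[of q] intrf integral_pmf_ratio[OF sub, of f] by (simp add: r_def)
  also have "\<dots>\<^sup>2 \<le> hellinger k q * (\<integral>z. ((sqrt (r z) + 1) * f z)\<^sup>2 \<partial>q)"
    using intm intpf intf[of q] intrf
    by (subst intm(2)[symmetric], intro Cauchy_Schwarz_integral) (simp_all add: eq)
  also have "\<dots> \<le> hellinger k q * (4 * L\<^sup>2)"
  proof (rule mult_left_mono)
    have "(\<integral>z. ((sqrt (r z) + 1) * f z)\<^sup>2 \<partial>q) \<le> (\<integral>z. L\<^sup>2 * (sqrt (r z) + 1)\<^sup>2 \<partial>q)"
      by (rule integral_mono) (use intp intpf le in auto)
    also have "\<dots> \<le> L\<^sup>2 * 4" using intp by (simp add: mult_left_mono)
    finally show "(\<integral>z. ((sqrt (r z) + 1) * f z)\<^sup>2 \<partial>q) \<le> 4 * L\<^sup>2" by simp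
    show "0 \<le> hellinger k q" using facts(4) by (simp add: hellinger_def r_def)
  qed
  finally show ?thesis by (simp add: mult_ac)
qed

text \<open>From \<open>- ln r = 2 * ln (1 / sqrt r) \<le> 2 * (1 / sqrt r - 1)\<close>.  The nonnegative integral
  avoids the question whether the logarithm is integrable.\<close>

lemma nn_integral_log_ratio_le:
  assumes sub: "set_pmf k \<subseteq> set_pmf q" and "c \<ge> 0"
    and nonneg: "\<And>z. z \<in> set_pmf k \<Longrightarrow> 0 \<le> a + c * ln (pmf q z / pmf k z)"
  shows "(\<integral>\<^sup>+z. ennreal (a + c * ln (pmf q z / pmf k z)) \<partial>k) \<le> ennreal (a - c * hellinger k q)"
proof -
  define r where "r z = pmf k z / pmf q z" for z
  \<comment> \<open>A majorant whose integral is known exactly: the \<open>k\<close>-integral of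
    \<open>1 / sqrt r\<close> is the \<open>q\<close>-integral of \<open>sqrt r\<close>, that is,
    \<open>1 - hellinger k q / 2\<close>.\<close>
  define g where "g z = a + 2 * c * (1 / sqrt (r z) - 1)" for z
  note facts = pmf_ratio_facts[OF sub, folded r_def]
  have r: "r z > 0" "ln (pmf q z / pmf k z) = - ln (r z)" if "z \<in> set_pmf k" for z
    using that sub unfolding r_def by (auto simp: pmf_positive ln_div subset_iff)
  have le: "a + c * ln (pmf q z / pmf k z) \<le> g z" if z: "z \<in> set_pmf k" for z
  proof -
    have "- ln (r z) = 2 * ln (1 / sqrt (r z))"
      using r[OF z] by (simp add: ln_div ln_sqrt)
    also have "\<dots> \<le> 2 * (1 / sqrt (r z) - 1)"
      using ln_le_minus_one[of "1 / sqrt (r z)"] r[OF z] by simp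
    finally have "c * - ln (r z) \<le> c * (2 * (1 / sqrt (r z) - 1))"
      using \<open>c \<ge> 0\<close> by (rule mult_left_mono)
    then show ?thesis unfolding r(2)[OF z] g_def by (simp add: mult_ac)
  qed
  \<comment> \<open>This includes \<open>r z = 0\<close>, since \<open>1 / 0 = 0\<close>.\<close>
  have rs: "r z * (1 / sqrt (r z)) = sqrt (r z)" for z
  proof -
    have "r z \<ge> 0" by (simp add: r_def)
    then show ?thesis by (simp add: real_div_sqrt)
  qed
  have int1: "integrable k (\<lambda>z. 1 / sqrt (r z))"
    using facts(3) integrable_pmf_ratio[OF sub, of "\<lambda>z. 1 / sqrt (r z)"] by (simp add: rs flip: r_def del: times_divide_eq_right)
  have "(\<integral>z. 1 / sqrt (r z) \<partial>k) = (\<integral>z. sqrt (r z) \<partial>q)"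
    using integral_pmf_ratio[OF sub, of "\<lambda>z. 1 / sqrt (r z)"] by (simp add: rs flip: r_def del: times_divide_eq_right)
  then have "has_bochner_integral k (\<lambda>z. 1 / sqrt (r z)) (\<integral>z. sqrt (r z) \<partial>q)"
    using int1 by (simp add: has_bochner_integral_iff)
  then have "has_bochner_integral k (\<lambda>z. (a - 2 * c) + (2 * c) * (1 / sqrt (r z)))
      ((a - 2 * c) + (2 * c) * (\<integral>z. sqrt (r z) \<partial>q))"
    by (intro has_bochner_integral_add has_bochner_integral_mult_right)
      (auto simp: has_bochner_integral_iff)
  moreover have "g = (\<lambda>z. (a - 2 * c) + (2 * c) * (1 / sqrt (r z)))"
    by (simp add: g_def fun_eq_iff algebra_simps)
  ultimately have intg: "(\<integral>z. g z \<partial>k) = a - c * hellinger k q" "integrable k g"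
    unfolding hellinger_def r_def[symmetric] by (simp_all add: has_bochner_integral_iff algebra_simps)
  have "(\<integral>\<^sup>+z. ennreal (a + c * ln (pmf q z / pmf k z)) \<partial>k) \<le> (\<integral>\<^sup>+z. ennreal (g z) \<partial>k)"
    by (intro nn_integral_mono_AE) (auto simp: AE_measure_pmf_iff intro!: ennreal_leI le)
  also have "\<dots> = ennreal (\<integral>z. g z \<partial>k)"
    by (intro nn_integral_eq_integral intg)
      (use le nonneg in \<open>force simp: AE_measure_pmf_iff intro: order_trans\<close>)
  finally show ?thesis by (simp add: intg)
qed

section \<open>Distributions of histories and predictions\<close>

text \<open>On a countable type the points of mass zero form a countable union of null sets, so
  together they are null, as the type of pmfs demands.\<close>

lemma measure_pmf_Abs_pmf:
  fixes M :: "'a::countable measure"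
  assumes "M \<in> space (prob_algebra (count_space UNIV))"
  shows "measure_pmf (Abs_pmf M) = M"
proof (rule Abs_pmf_inverse)
  have sets [simp]: "sets M = UNIV" and "prob_space M"
    using assms by (auto simp: space_prob_algebra)
  interpret prob_space M by fact
  have "(\<Union>x\<in>{x. measure M {x} = 0}. {x}) \<in> null_sets M"
    by (intro null_sets_UN') (auto simp: null_sets_def emeasure_eq_measure)
  then have "AE x in M. measure M {x} \<noteq> 0"
    by (intro AE_I'[of "{x. measure M {x} = 0}"]) auto
  then show "M \<in> {M. prob_space M \<and> sets M = UNIV \<and> (AE x in M. measure M {x} \<noteq> 0)}"
    using \<open>prob_space M\<close> by simp
qed

lemma history_Suc: "history (Suc n) \<omega> = history n \<omega> @ [\<omega> n]"
  by (simp add: history_def)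

lemma length_history [simp]: "length (history n \<omega>) = n"
  by (simp add: history_def)

lemma measurable_history [measurable]:
  "history n \<in> (seq_space :: (nat \<Rightarrow> 'z::countable) measure) \<rightarrow>\<^sub>M count_space UNIV"
proof (induction n)
  case 0
  have "history 0 = (\<lambda>_ :: nat \<Rightarrow> 'z. [])" by (simp add: history_def fun_eq_iff)
  then show ?case by simp
next
  case (Suc n)
  note [measurable] = Suc
  have "(\<lambda>\<omega> :: nat \<Rightarrow> 'z. history n \<omega> @ [\<omega> n]) \<in> seq_space \<rightarrow>\<^sub>M count_space UNIV"
    by (rule measurable_compose_countable[where g = "history n"]) measurable
  then show ?case by (simp add: history_Suc[abs_def])
qed

definition history_pmf :: "(nat \<Rightarrow> 'z) measure \<Rightarrow> nat \<Rightarrow> 'z list pmf" where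
  "history_pmf P n = Abs_pmf (distr P (count_space UNIV) (history n))"

text \<open>On a history of probability zero there is nothing to condition on, and
  \<open>Abs_pmf\<close> yields an unspecified pmf.\<close>

definition next_pmf :: "(nat \<Rightarrow> 'z) measure \<Rightarrow> 'z list \<Rightarrow> 'z pmf" where
  "next_pmf P zs = Abs_pmf (distr (uniform_measure P {\<omega> \<in> space P. history (length zs) \<omega> = zs})
     (count_space UNIV) (\<lambda>\<omega>. \<omega> (length zs)))"

section \<open>Marginals and one-step predictions\<close>

locale sequence_distribution =
  fixes P :: "(nat \<Rightarrow> 'z::countable) measure"
  assumes in_prob_algebra: "P \<in> space (prob_algebra seq_space)"
begin

lemma sets_P [measurable_cong]: "sets P = sets seq_space"
  using in_prob_algebra by (simp add: space_prob_algebra)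

lemma space_P [simp]: "space P = UNIV"
  using sets_eq_imp_space_eq[OF sets_P] by (simp add: space_PiM)

sublocale prob_space P
  using in_prob_algebra by (simp add: space_prob_algebra)

lemma measurable_history_P [simp]: "history n \<in> P \<rightarrow>\<^sub>M count_space UNIV"
  by measurable

lemma coordinate_sets [simp]: "{\<omega>. \<omega> n = z} \<in> sets P"
proof -
  have "{\<omega> \<in> space P. \<omega> n = z} \<in> sets P" by measurable
  then show ?thesis by simp
qed

lemma measurable_coordinate [simp]: "(\<lambda>\<omega>. \<omega> n) \<in> P \<rightarrow>\<^sub>M count_space UNIV"
  by measurable

lemma cylinder_prob_eq: "cylinder_prob P zs = prob {\<omega>. history (length zs) \<omega> = zs}"
  by (simp add: cylinder_prob_def)

lemma cylinder_sets [measurable, simp]: "{\<omega>. history n \<omega> = zs} \<in> sets P"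
proof -
  have "{\<omega> \<in> space P. history n \<omega> = zs} \<in> sets P" by measurable
  then show ?thesis by simp
qed

lemma cylinder_prob_Nil: "cylinder_prob P [] = 1"
  using prob_space by (simp add: cylinder_prob_eq history_def)

lemma cylinder_snoc:
  "{\<omega>. history (length (zs @ [z])) \<omega> = zs @ [z]} =
   {\<omega>. history (length zs) \<omega> = zs} \<inter> {\<omega>. \<omega> (length zs) = z}"
  by (auto simp: history_Suc)

lemma cylinder_prob_snoc_le: "cylinder_prob P (zs @ [z]) \<le> cylinder_prob P zs"
  unfolding cylinder_prob_eq cylinder_snoc by (intro finite_measure_mono) auto

lemma measure_history_pmf: "measure_pmf (history_pmf P n) = distr P (count_space UNIV) (history n)"
  unfolding history_pmf_def
  by (rule measure_pmf_Abs_pmf) (auto simp: space_prob_algebra intro!: prob_space_distr)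

lemma pmf_history_pmf:
  "pmf (history_pmf P n) zs = (if length zs = n then cylinder_prob P zs else 0)"
proof -
  have "pmf (history_pmf P n) zs = prob (history n -` {zs})"
    unfolding pmf.rep_eq measure_history_pmf by (subst measure_distr) auto
  moreover have "history n -` {zs} = {}" if "length zs \<noteq> n" using that by auto
  ultimately show ?thesis by (auto simp: cylinder_prob_eq vimage_def)
qed

lemma set_history_pmfD:
  "zs \<in> set_pmf (history_pmf P n) \<Longrightarrow> length zs = n \<and> 0 < cylinder_prob P zs"
  by (auto simp: set_pmf_iff pmf_history_pmf cylinder_prob_def less_le split: if_splits)

lemma measure_next_pmf:
  assumes "0 < cylinder_prob P zs"
  shows "measure_pmf (next_pmf P zs) =
    distr (uniform_measure P {\<omega>. history (length zs) \<omega> = zs}) (count_space UNIV) (\<lambda>\<omega>. \<omega> (length zs))"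
proof -
  have "prob_space (uniform_measure P {\<omega>. history (length zs) \<omega> = zs})"
    using assms by (intro prob_space_uniform_measure) (auto simp: emeasure_eq_measure cylinder_prob_eq)
  then show ?thesis
    unfolding next_pmf_def
    by (subst measure_pmf_Abs_pmf) (auto simp: space_prob_algebra intro!: prob_space.prob_space_distr)
qed

lemma pmf_next_pmf:
  assumes "0 < cylinder_prob P zs"
  shows "pmf (next_pmf P zs) z = cylinder_prob P (zs @ [z]) / cylinder_prob P zs"
proof -
  let ?A = "{\<omega>. history (length zs) \<omega> = zs}"
  have "pmf (next_pmf P zs) z = measure (uniform_measure P ?A) {\<omega>. \<omega> (length zs) = z}"
    unfolding pmf.rep_eq measure_next_pmf[OF assms] by (subst measure_distr) (auto simp: vimage_def)
  also have "\<dots> = prob (?A \<inter> {\<omega>. \<omega> (length zs) = z}) / prob ?A"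
    using assms
    by (intro measure_uniform_measure) (auto simp: emeasure_eq_measure cylinder_prob_eq)
  finally show ?thesis by (simp add: cylinder_prob_eq flip: cylinder_snoc)
qed

lemma history_pmf_0: "history_pmf P 0 = return_pmf []"
  by (rule pmf_eqI) (auto simp: pmf_history_pmf pmf_return cylinder_prob_Nil)

text \<open>The chain rule, by which expectations over histories are computed round by
  round.\<close>

lemma history_pmf_Suc:
  "history_pmf P (Suc n) =
   bind_pmf (history_pmf P n) (\<lambda>zs. map_pmf (\<lambda>z. zs @ [z]) (next_pmf P zs))"
proof (rule pmf_eqI)
  fix ys :: "'z list"
  show "pmf (history_pmf P (Suc n)) ys =
    pmf (bind_pmf (history_pmf P n) (\<lambda>zs. map_pmf (\<lambda>z. zs @ [z]) (next_pmf P zs))) ys"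
  proof (cases ys rule: rev_cases)
    case Nil
    have "pmf (map_pmf (\<lambda>z. zs @ [z]) (next_pmf P zs)) ys = 0" for zs
      using Nil by (simp add: pmf_eq_0_set_pmf image_iff)
    then show ?thesis using Nil by (simp add: pmf_bind pmf_history_pmf)
  next
    case (snoc us u)
    have "pmf (map_pmf (\<lambda>z. zs @ [z]) (next_pmf P zs)) ys =
        (if zs = us then pmf (next_pmf P us) u else 0)" for zs
    proof (cases "zs = us")
      case True
      then show ?thesis
        using snoc pmf_map_inj'[of "\<lambda>z. us @ [z]" "next_pmf P us" u] by (simp add: inj_def)
    next
      case False
      then show ?thesis using snoc by (auto simp: pmf_eq_0_set_pmf image_iff)
    qed
    then have "pmf (bind_pmf (history_pmf P n) (\<lambda>zs. map_pmf (\<lambda>z. zs @ [z]) (next_pmf P zs))) ys =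
        (\<integral>zs. (if zs = us then pmf (next_pmf P us) u else 0) \<partial>history_pmf P n)"
      by (simp add: pmf_bind)
    also have "\<dots> = pmf (history_pmf P n) us * pmf (next_pmf P us) u"
      by (subst integral_measure_pmf_real[of "{us}"]) (auto split: if_splits)
    also have "\<dots> = pmf (history_pmf P (Suc n)) ys"
    proof (cases "cylinder_prob P us > 0")
      case True
      then show ?thesis using snoc by (simp add: pmf_history_pmf pmf_next_pmf)
    next
      \<comment> \<open>The unspecified \<open>next_pmf P us\<close> is harmless: both sides vanish,
        since an extension is at most as likely as its prefix.\<close>
      case False
      then have "cylinder_prob P us = 0" "cylinder_prob P (us @ [u]) = 0"
        using cylinder_prob_snoc_le[of us u] by (auto simp: cylinder_prob_def not_less measure_le_0_iff)
      then show ?thesis using snoc by (simp add: pmf_history_pmf)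
    qed
    finally show ?thesis ..
  qed
qed

text \<open>A version is determined only almost everywhere, but a cylinder of positive probability
  is not a null set and \<open>\<kappa> (history n \<omega>)\<close> is constant on it. Integrating
  over the cylinder fixes that constant.\<close>

lemma conditional_distribution_unique:
  assumes \<kappa>: "conditional_distribution P \<kappa>" and pos: "0 < cylinder_prob P zs"
  shows "\<kappa> zs = measure_pmf (next_pmf P zs)"
proof (rule measure_eqI_countable[where A = UNIV])
  have \<kappa>_prob: "\<kappa> zs \<in> space (prob_algebra (count_space UNIV))" for zs
    using \<kappa> by (auto simp: conditional_distribution_def dest: measurable_space)
  then show "sets (\<kappa> zs) = Pow UNIV" by (simp add: space_prob_algebra)
  interpret \<kappa>: prob_space "\<kappa> zs" using \<kappa>_prob by (simp add: space_prob_algebra)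
  fix z :: 'z
  define n where "n = length zs"
  define F where "F = vimage_algebra (space P) (history n) (count_space UNIV)"
  define A where "A = {\<omega>. history n \<omega> = zs}"
  have A: "A \<in> sets P" "A \<in> sets F"
    using in_vimage_algebra[of "{zs}" "count_space UNIV" "history n" "space P"]
    by (auto simp: A_def F_def vimage_def)
  have sub: "subalgebra P F"
    unfolding subalgebra_def F_def
  proof (intro conjI subsetI)
    fix B assume "B \<in> sets (vimage_algebra (space P) (history n) (count_space UNIV))"
    then obtain X where "B = history n -` X \<inter> space P"
      by (subst (asm) sets_vimage_algebra2) auto
    then show "B \<in> sets P" using measurable_sets[OF measurable_history_P, of X n] by simp
  qed simp
  interpret finite_measure_subalgebra P F
    using sub by unfold_locales
  let ?B = "{\<omega>. \<omega> n = z}"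
  have B: "?B \<in> sets P" by simp
  have ind: "(\<lambda>\<omega>. indicator {z} (\<omega> n)) = (indicator ?B :: _ \<Rightarrow> real)"
    by (auto simp: indicator_def fun_eq_iff)
  have ae: "AE \<omega> in P. measure (\<kappa> (history n \<omega>)) {z} = real_cond_exp P F (indicator ?B) \<omega>"
    using \<kappa> unfolding conditional_distribution_def F_def ind[symmetric] by blast
  have "prob (A \<inter> ?B) = (\<integral>\<omega>\<in>A. indicator ?B \<omega> \<partial>P)"
    using A B by (simp add: set_lebesgue_integral_def indicator_inter_arith[symmetric])
  also have "\<dots> = (\<integral>\<omega>\<in>A. real_cond_exp P F (indicator ?B) \<omega> \<partial>P)"
    using A B by (intro real_cond_exp_intA) (auto simp: emeasure_eq_measure)
  also have "\<dots> = (\<integral>\<omega>. indicator A \<omega> * measure (\<kappa> zs) {z} \<partial>P)"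
    unfolding set_lebesgue_integral_def
  proof (rule integral_cong_AE)
    show "AE \<omega> in P. indicator A \<omega> *\<^sub>R real_cond_exp P F (indicator ?B) \<omega> =
        indicator A \<omega> * measure (\<kappa> zs) {z}"
      using ae by eventually_elim (auto simp: A_def indicator_def)
  qed (use A in auto)
  also have "\<dots> = prob A * measure (\<kappa> zs) {z}" using A by simp
  finally have "prob (A \<inter> ?B) = prob A * measure (\<kappa> zs) {z}" .
  then have "cylinder_prob P (zs @ [z]) = cylinder_prob P zs * measure (\<kappa> zs) {z}"
    unfolding cylinder_prob_eq cylinder_snoc by (simp add: A_def n_def)
  then have "measure (\<kappa> zs) {z} = pmf (next_pmf P zs) z"
    using pos by (simp add: pmf_next_pmf)
  then show "emeasure (\<kappa> zs) {z} = emeasure (measure_pmf (next_pmf P zs)) {z}"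
    by (simp add: \<kappa>.emeasure_eq_measure emeasure_pmf_single)
qed simp_all

end

section \<open>Regret against a dominated distribution\<close>

definition path_sum :: "('z list \<Rightarrow> 'z \<Rightarrow> real) \<Rightarrow> 'z list \<Rightarrow> real" where
  "path_sum g zs = (\<Sum>t<length zs. g (take t zs) (zs ! t))"

lemma path_sum_Nil [simp]: "path_sum g [] = 0"
  by (simp add: path_sum_def)

lemma path_sum_snoc [simp]: "path_sum g (zs @ [z]) = path_sum g zs + g zs z"
proof -
  have "(\<Sum>t<length zs. g (take t (zs @ [z])) ((zs @ [z]) ! t)) = path_sum g zs"
    unfolding path_sum_def by (rule sum.cong) (auto simp: nth_append)
  then show ?thesis by (simp add: path_sum_def)
qed

lemma path_sum_history: "path_sum g (history T \<omega>) = (\<Sum>t<T. g (history t \<omega>) (\<omega> t))"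
  by (induction T) (simp_all add: history_Suc, simp add: history_def)

text \<open>Iterates a one-step bound through the chain rule; \<open>c = 0\<close> is the case of a
  nonnegative supermartingale. Values in \<open>ennreal\<close> avoid integrability
  conditions.\<close>

lemma (in sequence_distribution) nn_integral_history_pmf_le:
  fixes f :: "'z list \<Rightarrow> ennreal"
  assumes "\<And>zs. 0 < cylinder_prob P zs \<Longrightarrow> (\<integral>\<^sup>+z. f (zs @ [z]) \<partial>next_pmf P zs) \<le> f zs + c"
  shows "(\<integral>\<^sup>+zs. f zs \<partial>history_pmf P n) \<le> f [] + of_nat n * c"
proof (induction n)
  case 0
  then show ?case by (simp add: history_pmf_0)
next
  case (Suc n)
  have "(\<integral>\<^sup>+zs. f zs \<partial>history_pmf P (Suc n)) =
      (\<integral>\<^sup>+zs. \<integral>\<^sup>+z. f (zs @ [z]) \<partial>next_pmf P zs \<partial>history_pmf P n)"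
    by (simp add: history_pmf_Suc nn_integral_bind_pmf)
  also have "\<dots> \<le> (\<integral>\<^sup>+zs. f zs + c \<partial>history_pmf P n)"
    by (intro nn_integral_mono_AE) (auto simp: AE_measure_pmf_iff dest!: set_history_pmfD intro: assms)
  also have "\<dots> = (\<integral>\<^sup>+zs. f zs \<partial>history_pmf P n) + c"
    by (simp add: nn_integral_add)
  also have "\<dots> \<le> f [] + of_nat n * c + c" by (rule add_right_mono) (rule Suc.IH)
  finally show ?case by (simp add: algebra_simps)
qed

text \<open>\<open>d zs z\<close> is the loss of the decision that is optimal under the predictions of \<open>U\<close> minus
  the loss of the \<open>P\<close>-optimal decision, after the history \<open>zs\<close> and on the outcome \<open>z\<close>.\<close>

locale dominated_prediction = P: sequence_distribution P + U: sequence_distribution U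
  for P U :: "(nat \<Rightarrow> 'z::countable) measure" +
  fixes w L :: real and d :: "'z list \<Rightarrow> 'z \<Rightarrow> real"
  assumes w_pos: "0 < w"
    and dominated: "\<And>zs. w * cylinder_prob P zs \<le> cylinder_prob U zs"
    and d_bounded: "\<And>zs z. \<bar>d zs z\<bar> \<le> L"
    and d_nonneg: "\<And>zs. 0 < cylinder_prob P zs \<Longrightarrow> 0 \<le> (\<integral>z. d zs z \<partial>next_pmf P zs)"
    and d_nonpos: "\<And>zs. 0 < cylinder_prob P zs \<Longrightarrow> (\<integral>z. d zs z \<partial>next_pmf U zs) \<le> 0"
begin

definition drift :: "'z list \<Rightarrow> real" where
  "drift zs = (\<integral>z. d zs z \<partial>next_pmf P zs)"

text \<open>The martingale part of the Doob decomposition of \<open>path_sum d\<close> under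
  \<open>P\<close>; the predictable part is the sum of the drifts.\<close>

definition noise :: "'z list \<Rightarrow> real" where
  "noise = path_sum (\<lambda>zs z. d zs z - drift zs)"

definition sq_drift :: "'z list \<Rightarrow> real" where
  "sq_drift = path_sum (\<lambda>zs z. (drift zs)\<^sup>2)"

lemma U_pos: "0 < cylinder_prob P zs \<Longrightarrow> 0 < cylinder_prob U zs"
  using dominated[of zs] w_pos by (meson less_le_trans mult_pos_pos)

lemma P_snoc_pos:
  assumes "0 < cylinder_prob P zs" "z \<in> set_pmf (next_pmf P zs)"
  shows "0 < cylinder_prob P (zs @ [z])"
  using assms P.pmf_next_pmf[of zs z] by (auto simp: set_pmf_iff cylinder_prob_def less_le)

lemma next_pmf_subset:
  assumes "0 < cylinder_prob P zs"
  shows "set_pmf (next_pmf P zs) \<subseteq> set_pmf (next_pmf U zs)"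
proof
  fix z assume "z \<in> set_pmf (next_pmf P zs)"
  then have "0 < cylinder_prob U (zs @ [z])" using assms P_snoc_pos U_pos by blast
  then show "z \<in> set_pmf (next_pmf U zs)"
    using U.pmf_next_pmf[OF U_pos[OF assms], of z] U_pos[OF assms] by (auto simp: set_pmf_iff)
qed

section \<open>Second moment of the martingale part\<close>

lemma integrable_d: "integrable (measure_pmf p) (d zs)"
  by (rule measure_pmf.integrable_const_bound[of _ L]) (use d_bounded in auto)

text \<open>Martingale increments are orthogonal, so each round adds only a conditional variance,
  which is at most \<open>L\<^sup>2\<close>.\<close>

lemma nn_integral_noise:
  "(\<integral>\<^sup>+zs. ennreal ((noise zs)\<^sup>2) \<partial>history_pmf P n) \<le> ennreal (real n * L\<^sup>2)"
proof -
  have "(\<integral>\<^sup>+z. ennreal ((noise (zs @ [z]))\<^sup>2) \<partial>next_pmf P zs) \<le> ennreal ((noise zs)\<^sup>2) + ennreal (L\<^sup>2)"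
    for zs
  proof -
    let ?k = "next_pmf P zs" and ?m = "noise zs" and ?x = "drift zs"
    have d2: "(d zs z)\<^sup>2 \<le> L\<^sup>2" for z
      using d_bounded[of zs z] by (metis abs_ge_zero power2_abs power_mono)
    have int2: "integrable ?k (\<lambda>z. (d zs z)\<^sup>2)"
      by (rule measure_pmf.integrable_const_bound[of _ "L\<^sup>2"]) (use d2 in auto)
    have eq: "(noise (zs @ [z]))\<^sup>2 = (?m - ?x)\<^sup>2 + 2 * (?m - ?x) * d zs z + (d zs z)\<^sup>2" for z
      by (simp add: noise_def power2_eq_square algebra_simps)
    have int: "integrable ?k (\<lambda>z. (noise (zs @ [z]))\<^sup>2)"
      unfolding eq using integrable_d int2 by simp
    have "(\<integral>z. (noise (zs @ [z]))\<^sup>2 \<partial>?k) = (?m - ?x)\<^sup>2 + 2 * (?m - ?x) * ?x + (\<integral>z. (d zs z)\<^sup>2 \<partial>?k)"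
      unfolding eq using integrable_d int2 by (simp add: drift_def)
    also have "\<dots> = ?m\<^sup>2 - ?x\<^sup>2 + (\<integral>z. (d zs z)\<^sup>2 \<partial>?k)"
      by (simp add: power2_eq_square algebra_simps)
    also have "\<dots> \<le> ?m\<^sup>2 + L\<^sup>2"
    proof -
      have "(\<integral>z. (d zs z)\<^sup>2 \<partial>?k) \<le> L\<^sup>2"
        using int2 d2 by (intro measure_pmf.integral_le_const) auto
      then show ?thesis using zero_le_power2[of ?x] by linarith
    qed
    finally have le: "(\<integral>z. (noise (zs @ [z]))\<^sup>2 \<partial>?k) \<le> ?m\<^sup>2 + L\<^sup>2" .
    have "(\<integral>\<^sup>+z. ennreal ((noise (zs @ [z]))\<^sup>2) \<partial>?k) = ennreal (\<integral>z. (noise (zs @ [z]))\<^sup>2 \<partial>?k)"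
      using int by (intro nn_integral_eq_integral) auto
    also have "\<dots> \<le> ennreal (?m\<^sup>2 + L\<^sup>2)" using le by (rule ennreal_leI)
    finally show ?thesis by simp
  qed
  from P.nn_integral_history_pmf_le[of "\<lambda>zs. ennreal ((noise zs)\<^sup>2)", OF this] show ?thesis
    by (simp add: noise_def ennreal_mult ennreal_of_nat_eq_real_of_nat)
qed

section \<open>The logarithmic potential and the squared drifts\<close>

text \<open>The logarithm is the log-likelihood ratio of \<open>U\<close> to \<open>P\<close>,
  shifted by \<open>ln (1 / w)\<close> so that domination makes it nonnegative. The factor is that
  of \<open>drift_le_hellinger\<close>: the expected fall of the logarithm pays for the growth of
  \<open>sq_drift\<close>.\<close>

definition potential :: "'z list \<Rightarrow> real" where
  "potential zs = sq_drift zs + 4 * L\<^sup>2 * ln (cylinder_prob U zs / (w * cylinder_prob P zs))"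

lemma sq_drift_nonneg: "0 \<le> sq_drift zs"
  by (simp add: sq_drift_def path_sum_def sum_nonneg)

lemma sq_drift_le_potential:
  assumes "0 < cylinder_prob P zs"
  shows "sq_drift zs \<le> potential zs"
proof -
  have "1 \<le> cylinder_prob U zs / (w * cylinder_prob P zs)"
    using dominated[of zs] assms w_pos by (simp add: divide_simps)
  then show ?thesis unfolding potential_def by (simp add: ln_ge_zero)
qed

text \<open>The expectations of \<open>d zs\<close> under the two predictions lie on opposite sides
  of zero, so \<open>drift zs\<close> is at most their difference.\<close>

lemma drift_le_hellinger:
  assumes "0 < cylinder_prob P zs"
  shows "(drift zs)\<^sup>2 \<le> 4 * L\<^sup>2 * hellinger (next_pmf P zs) (next_pmf U zs)"
proof -
  have "(drift zs)\<^sup>2 \<le> ((\<integral>z. d zs z \<partial>next_pmf P zs) - (\<integral>z. d zs z \<partial>next_pmf U zs))\<^sup>2"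
    unfolding drift_def using d_nonneg[OF assms] d_nonpos[OF assms] by (intro power_mono) auto
  also have "\<dots> \<le> 4 * L\<^sup>2 * hellinger (next_pmf P zs) (next_pmf U zs)"
    by (intro expectation_diff_le_hellinger next_pmf_subset assms d_bounded)
  finally show ?thesis .
qed

lemma potential_supermartingale:
  assumes pos: "0 < cylinder_prob P zs"
  shows "(\<integral>\<^sup>+z. ennreal (potential (zs @ [z])) \<partial>next_pmf P zs) \<le> ennreal (potential zs)"
proof -
  let ?k = "next_pmf P zs" and ?q = "next_pmf U zs"
  \<comment> \<open>The part of the next potential that does not depend on the outcome
    \<open>z\<close>; the new squared drift is already fixed by \<open>zs\<close>.\<close>
  define a where "a = potential zs + (drift zs)\<^sup>2"
  note posU = U_pos[OF pos]
  have step: "potential (zs @ [z]) = a + 4 * L\<^sup>2 * ln (pmf ?q z / pmf ?k z)" if z: "z \<in> set_pmf ?k" for z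
  proof -
    have k: "0 < pmf ?k z" and q: "0 < pmf ?q z"
      using z next_pmf_subset[OF pos] by (auto intro: pmf_positive)
    have "cylinder_prob U (zs @ [z]) / (w * cylinder_prob P (zs @ [z])) =
        (cylinder_prob U zs / (w * cylinder_prob P zs)) * (pmf ?q z / pmf ?k z)"
      using pos posU k q w_pos by (simp add: P.pmf_next_pmf U.pmf_next_pmf)
    also have "ln \<dots> = ln (cylinder_prob U zs / (w * cylinder_prob P zs)) + ln (pmf ?q z / pmf ?k z)"
      using pos posU k q w_pos by (intro ln_mult_pos) simp_all
    finally show ?thesis by (simp add: potential_def a_def sq_drift_def algebra_simps)
  qed
  have "(\<integral>\<^sup>+z. ennreal (potential (zs @ [z])) \<partial>?k) =
      (\<integral>\<^sup>+z. ennreal (a + 4 * L\<^sup>2 * ln (pmf ?q z / pmf ?k z)) \<partial>?k)"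
    by (intro nn_integral_cong_AE) (simp add: AE_measure_pmf_iff step)
  also have "\<dots> \<le> ennreal (a - 4 * L\<^sup>2 * hellinger ?k ?q)"
  proof (rule nn_integral_log_ratio_le[OF next_pmf_subset[OF pos]])
    fix z assume z: "z \<in> set_pmf ?k"
    \<comment> \<open>This is the potential of the extended history, nonnegative by domination
      there.\<close>
    show "0 \<le> a + 4 * L\<^sup>2 * ln (pmf ?q z / pmf ?k z)"
      unfolding step[OF z, symmetric]
      using sq_drift_le_potential[OF P_snoc_pos[OF pos z]] sq_drift_nonneg by (rule order_trans[rotated])
  qed simp
  also have "\<dots> \<le> ennreal (potential zs)"
    using drift_le_hellinger[OF pos] by (intro ennreal_leI) (simp add: a_def)
  finally show ?thesis .
qed

text \<open>The potential cannot grow on average, so its initial value bounds the squared drifts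
  uniformly in \<open>n\<close>.\<close>

lemma nn_integral_sq_drift:
  "(\<integral>\<^sup>+zs. ennreal (sq_drift zs) \<partial>history_pmf P n) \<le> ennreal (4 * L\<^sup>2 * ln (1 / w))"
proof -
  have "(\<integral>\<^sup>+zs. ennreal (sq_drift zs) \<partial>history_pmf P n) \<le> (\<integral>\<^sup>+zs. ennreal (potential zs) \<partial>history_pmf P n)"
    by (intro nn_integral_mono_AE)
      (auto simp: AE_measure_pmf_iff dest!: P.set_history_pmfD intro!: ennreal_leI sq_drift_le_potential)
  also have "\<dots> \<le> ennreal (potential []) + of_nat n * 0"
    by (intro P.nn_integral_history_pmf_le) (simp add: potential_supermartingale)
  also have "potential [] = 4 * L\<^sup>2 * ln (1 / w)"
    by (simp add: potential_def sq_drift_def P.cylinder_prob_Nil U.cylinder_prob_Nil)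
  finally show ?thesis by simp
qed

section \<open>Second moment and tail of the regret\<close>

lemma path_sum_sq_le: "(path_sum d zs)\<^sup>2 \<le> 2 * (noise zs)\<^sup>2 + 2 * real (length zs) * sq_drift zs"
proof -
  define X where "X = path_sum (\<lambda>zs z. drift zs) zs"
  have "path_sum d zs = noise zs + X"
    by (simp add: noise_def X_def path_sum_def flip: sum.distrib)
  \<comment> \<open>Cauchy-Schwarz over the rounds, at the cost of the factor
    \<open>length zs\<close>.\<close>
  moreover have "X\<^sup>2 \<le> sq_drift zs * real (length zs)"
    unfolding X_def path_sum_def sq_drift_def
    using sum_squared_le_sum_of_squares[of "\<lambda>t. drift (take t zs)" "{..<length zs}"] by simp
  moreover have "(noise zs + X)\<^sup>2 \<le> 2 * (noise zs)\<^sup>2 + 2 * X\<^sup>2"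
    using zero_le_power2[of "noise zs - X"] by (simp add: power2_eq_square algebra_simps)
  ultimately show ?thesis by (simp add: algebra_simps)
qed

lemma w_le_1: "w \<le> 1"
  using dominated[of "[]"] by (simp add: P.cylinder_prob_Nil U.cylinder_prob_Nil)

text \<open>Both parts grow linearly: the noise through its variances, the drift because the factor
  \<open>n\<close> from Cauchy-Schwarz meets a bound independent of \<open>n\<close>.\<close>

lemma nn_integral_path_sum_sq:
  "(\<integral>\<^sup>+zs. ennreal ((path_sum d zs)\<^sup>2) \<partial>history_pmf P n)
     \<le> ennreal (real n * (2 * L\<^sup>2 * (1 + 4 * ln (1 / w))))"
proof -
  have ln: "0 \<le> ln (1 / w)" using w_pos w_le_1 by (intro ln_ge_zero) simp
  have "(\<integral>\<^sup>+zs. ennreal ((path_sum d zs)\<^sup>2) \<partial>history_pmf P n)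
      \<le> (\<integral>\<^sup>+zs. ennreal 2 * ennreal ((noise zs)\<^sup>2) + ennreal (2 * real n) * ennreal (sq_drift zs) \<partial>history_pmf P n)"
  proof (intro nn_integral_mono_AE, unfold AE_measure_pmf_iff, intro ballI)
    fix zs assume "zs \<in> set_pmf (history_pmf P n)"
    then have "(path_sum d zs)\<^sup>2 \<le> 2 * (noise zs)\<^sup>2 + 2 * real n * sq_drift zs"
      using path_sum_sq_le[of zs] P.set_history_pmfD by blast
    then have "ennreal ((path_sum d zs)\<^sup>2) \<le> ennreal (2 * (noise zs)\<^sup>2 + 2 * real n * sq_drift zs)"
      by (rule ennreal_leI)
    then show "ennreal ((path_sum d zs)\<^sup>2)
        \<le> ennreal 2 * ennreal ((noise zs)\<^sup>2) + ennreal (2 * real n) * ennreal (sq_drift zs)"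
      using sq_drift_nonneg[of zs] by (simp only: ennreal_plus ennreal_mult zero_le_power2 zero_le_numeral
          mult_nonneg_nonneg of_nat_0_le_iff)
  qed
  also have "\<dots> = ennreal 2 * (\<integral>\<^sup>+zs. ennreal ((noise zs)\<^sup>2) \<partial>history_pmf P n)
      + ennreal (2 * real n) * (\<integral>\<^sup>+zs. ennreal (sq_drift zs) \<partial>history_pmf P n)"
    by (simp add: nn_integral_add nn_integral_cmult)
  also have "\<dots> \<le> ennreal 2 * ennreal (real n * L\<^sup>2) + ennreal (2 * real n) * ennreal (4 * L\<^sup>2 * ln (1 / w))"
    by (intro add_mono mult_left_mono nn_integral_noise nn_integral_sq_drift) simp_all
  also have "\<dots> = ennreal (2 * (real n * L\<^sup>2) + 2 * real n * (4 * L\<^sup>2 * ln (1 / w)))"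
    using ln by (simp only: ennreal_plus ennreal_mult zero_le_power2 zero_le_numeral
          mult_nonneg_nonneg of_nat_0_le_iff)
  finally show ?thesis by (simp add: algebra_simps)
qed

lemma average_tail_bound:
  assumes "1 \<le> T" and \<delta>: "0 < \<delta>" "\<delta> < 1" and "0 < C"
    and C: "2 * L\<^sup>2 * (1 + 4 * ln (1 / w)) \<le> C\<^sup>2"
  shows "1 - \<delta> \<le> measure P {\<omega> \<in> space P.
    1 / real T * (\<Sum>t<T. d (history t \<omega>) (\<omega> t)) < C / sqrt (real T * \<delta>)}"
proof -
  \<comment> \<open>The threshold for the total regret, at which Markov's bound
    \<open>T * C\<^sup>2 / a\<^sup>2\<close> equals \<delta>.\<close>
  define a where "a = real T * (C / sqrt (real T * \<delta>))"
  have a: "0 < a" using assms by (simp add: a_def)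
  have a2: "a\<^sup>2 = C\<^sup>2 * real T / \<delta>"
    using assms by (simp add: a_def power_mult_distrib power_divide power2_eq_square)
  define B where "B = {zs. 1 / real T * path_sum d zs < C / sqrt (real T * \<delta>)}"
  have B: "B = {zs. path_sum d zs < a}"
    using \<open>1 \<le> T\<close> by (simp add: B_def a_def field_simps)
  have "emeasure (history_pmf P T) (- B)
      \<le> emeasure (history_pmf P T) {zs \<in> UNIV. 1 \<le> ennreal (1 / a\<^sup>2) * ennreal ((path_sum d zs)\<^sup>2)}"
  proof (intro emeasure_mono subsetI)
    \<comment> \<open>Outside \<open>B\<close> the sum is at least \<open>a > 0\<close>, so squaring
      preserves the inequality.\<close>
    fix zs assume "zs \<in> - B"
    then have "a\<^sup>2 \<le> (path_sum d zs)\<^sup>2" using a by (intro power_mono) (auto simp: B)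
    then have "ennreal 1 \<le> ennreal (1 / a\<^sup>2 * (path_sum d zs)\<^sup>2)"
      using a by (intro ennreal_leI) simp
    also have "\<dots> = ennreal (1 / a\<^sup>2) * ennreal ((path_sum d zs)\<^sup>2)"
      by (rule ennreal_mult) auto
    finally show "zs \<in> {zs \<in> UNIV. 1 \<le> ennreal (1 / a\<^sup>2) * ennreal ((path_sum d zs)\<^sup>2)}"
      by simp
  qed simp
  also have "\<dots> \<le> ennreal (1 / a\<^sup>2) * (\<integral>\<^sup>+zs. ennreal ((path_sum d zs)\<^sup>2) * indicator UNIV zs \<partial>history_pmf P T)"
    by (rule nn_integral_Markov_inequality) auto
  also have "\<dots> \<le> ennreal (1 / a\<^sup>2) * ennreal (real T * C\<^sup>2)"
    using nn_integral_path_sum_sq[of T] C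
    by (intro mult_left_mono) (auto intro!: ennreal_leI mult_left_mono elim!: order_trans)
  also have "\<dots> = ennreal (1 / a\<^sup>2 * (real T * C\<^sup>2))" by (rule ennreal_mult[symmetric]) auto
  also have "1 / a\<^sup>2 * (real T * C\<^sup>2) = \<delta>"
    using assms by (simp add: a2)
  finally have "measure (history_pmf P T) (- B) \<le> \<delta>"
    using \<delta> by (simp add: measure_pmf.emeasure_eq_measure)
  then have "1 - \<delta> \<le> measure (history_pmf P T) B"
    using measure_pmf.prob_compl[of B "history_pmf P T"] by (simp add: Compl_eq_Diff_UNIV)
  also have "measure (history_pmf P T) B = measure P (history T -` B)"
    unfolding P.measure_history_pmf by (subst measure_distr) auto
  finally show ?thesis by (simp add: B_def path_sum_history vimage_def)
qed

end

section \<open>The universal mixture\<close>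

text \<open>Determinism makes all distributions computed by one program agree on cylinders, so one
  distribution per program code suffices to dominate all computable ones.  Codes of programs that
  compute no distribution get an arbitrary point mass.\<close>

definition representative :: "('z::countable \<Rightarrow> nat) \<Rightarrow> nat \<Rightarrow> (nat \<Rightarrow> 'z) measure" where
  "representative e i =
     (if \<exists>P. P \<in> space (prob_algebra seq_space) \<and> computes_cylinders e (from_nat i) P
      then SOME P. P \<in> space (prob_algebra seq_space) \<and> computes_cylinders e (from_nat i) P
      else return seq_space (\<lambda>_. undefined))"

lemma representative_in_prob_algebra: "representative e i \<in> space (prob_algebra seq_space)"
proof (cases "\<exists>P. P \<in> space (prob_algebra seq_space) \<and> computes_cylinders e (from_nat i) P")
  case True
  then show ?thesis using someI_ex[OF True] by (simp add: representative_def)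
next
  case False
  then show ?thesis
    unfolding representative_def if_not_P[OF False]
    by (auto simp: space_prob_algebra space_PiM intro!: prob_space_return)
qed

text \<open>The chosen representative may differ from \<open>P\<close>, but \<open>p\<close>
  computes both.\<close>

lemma cylinder_prob_representative:
  assumes "P \<in> space (prob_algebra seq_space)" "computes_cylinders e p P"
  shows "cylinder_prob (representative e (to_nat p)) zs = cylinder_prob P zs"
proof -
  have "computes_cylinders e p (representative e (to_nat p))"
    using assms someI_ex[of "\<lambda>P. P \<in> space (prob_algebra seq_space) \<and> computes_cylinders e p P"]
    by (auto simp: representative_def)
  then show ?thesis using assms(2) by (rule computes_cylinders_unique)
qed

text \<open>The geometric distribution gives every program code positive weight.\<close>

definition mixture :: "('z::countable \<Rightarrow> nat) \<Rightarrow> (nat \<Rightarrow> 'z) measure" where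
  "mixture e = measure_pmf (geometric_pmf (1 / 2)) \<bind> representative e"

lemma measurable_representative:
  "representative e \<in> measure_pmf p \<rightarrow>\<^sub>M subprob_algebra seq_space"
  using representative_in_prob_algebra[of e]
  by (auto simp: space_prob_algebra space_subprob_algebra intro: prob_space_imp_subprob_space)

lemma mixture_in_prob_algebra: "mixture e \<in> space (prob_algebra seq_space)"
proof -
  have sets: "sets (mixture e) = sets seq_space"
    unfolding mixture_def
    using representative_in_prob_algebra[of e] by (intro sets_bind) (auto simp: space_prob_algebra)
  have "prob_space (mixture e)"
    unfolding mixture_def
    using representative_in_prob_algebra[of e] measurable_representative
    by (intro measure_pmf.prob_space_bind[where S = seq_space]) (auto simp: space_prob_algebra)
  with sets show ?thesis by (simp add: space_prob_algebra)
qed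

text \<open>Only the \<open>i\<close>-th term of the mixture is kept.\<close>

lemma cylinder_prob_mixture_ge:
  "pmf (geometric_pmf (1 / 2)) i * cylinder_prob (representative e i) zs \<le> cylinder_prob (mixture e) zs"
proof -
  let ?G = "geometric_pmf (1 / 2)" and ?R = "representative e"
  let ?A = "{\<omega>. history (length zs) \<omega> = zs}"
  interpret R: sequence_distribution "?R j" for j
    by unfold_locales (rule representative_in_prob_algebra)
  interpret U: sequence_distribution "mixture e"
    by unfold_locales (rule mixture_in_prob_algebra)
  have "ennreal (pmf ?G i * cylinder_prob (?R i) zs) = (\<integral>\<^sup>+j. emeasure (?R i) ?A * indicator {i} j \<partial>?G)"
    by (subst nn_integral_cmult_indicator)
      (simp_all add: emeasure_pmf_single R.cylinder_prob_eq R.emeasure_eq_measure mult.commute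
        flip: ennreal_mult)
  also have "\<dots> \<le> (\<integral>\<^sup>+j. emeasure (?R j) ?A \<partial>?G)"
    by (intro nn_integral_mono) (auto simp: indicator_def)
  also have "\<dots> = emeasure (mixture e) ?A"
    unfolding mixture_def using measurable_representative U.cylinder_sets U.sets_P
    by (intro emeasure_bind[symmetric, where N = seq_space]) auto
  finally show ?thesis by (simp add: U.cylinder_prob_eq U.emeasure_eq_measure)
qed

text \<open>It depends on \<open>e\<close> and \<open>P\<close> alone, so the constant of the
  theorem can be fixed before the decision space and the loss.\<close>

definition weight :: "('z::countable \<Rightarrow> nat) \<Rightarrow> (nat \<Rightarrow> 'z) measure \<Rightarrow> real" where
  "weight e P = pmf (geometric_pmf (1 / 2)) (to_nat (SOME p. computes_cylinders e p P))"

lemma weight_pos: "0 < weight e P"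
  by (simp add: weight_def)

lemma computable_dominated:
  assumes "computable_distribution e P"
  shows "weight e P * cylinder_prob P zs \<le> cylinder_prob (mixture e) zs"
proof -
  let ?p = "SOME p. computes_cylinders e p P"
  have P: "P \<in> space (prob_algebra seq_space)" and ex: "\<exists>p. computes_cylinders e p P"
    using assms by (auto simp: computable_distribution_alt)
  from someI_ex[OF ex] have "computes_cylinders e ?p P" .
  from cylinder_prob_representative[OF P this] show ?thesis
    using cylinder_prob_mixture_ge[of "to_nat ?p" e zs] by (simp add: weight_def)
qed

section \<open>The universal policy and its regret bound\<close>

theorem theorem2:
  fixes e :: "'z::countable \<Rightarrow> nat"
  assumes "identification e"
  shows "\<exists>C :: (nat \<Rightarrow> 'z) measure \<Rightarrow> real \<Rightarrow> real.
    \<forall>(H :: 'b measure) L loss.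
      0 \<le> L \<longrightarrow> loss_function H L loss \<longrightarrow> minimum_attained H loss \<longrightarrow>
      (\<exists>b. policy H b \<and>
        (\<forall>P. computable_distribution e P \<longrightarrow>
          0 < C P L \<and>
          (\<forall>\<kappa> b_opt. conditional_distribution P \<kappa> \<longrightarrow> optimal_policy H loss \<kappa> b_opt \<longrightarrow>
            (\<forall>T \<ge> 1. \<forall>\<delta> \<in> {0<..<1}.
              measure P {\<omega> \<in> space P. regret loss b b_opt T \<omega> < C P L / sqrt (real T * \<delta>)}
                \<ge> 1 - \<delta>))))"
proof -
  \<comment> \<open>The \<open>+ 1\<close> keeps \<open>C P L\<close> positive when
    \<open>L = 0\<close>.\<close>
  define C :: "(nat \<Rightarrow> 'z) measure \<Rightarrow> real \<Rightarrow> real"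
    where "C P L = sqrt (2 * L\<^sup>2 * (1 + 4 * ln (1 / weight e P)) + 1)" for P L
  have C_sq: "2 * L\<^sup>2 * (1 + 4 * ln (1 / weight e P)) \<le> (C P L)\<^sup>2" and C_pos: "0 < C P L" for P L
  proof -
    have "weight e P \<le> 1" unfolding weight_def by (rule pmf_le_1)
    then have "0 \<le> ln (1 / weight e P)" using weight_pos[of e P] by (intro ln_ge_zero) simp
    then have "0 \<le> 2 * L\<^sup>2 * (1 + 4 * ln (1 / weight e P))" by simp
    then show "2 * L\<^sup>2 * (1 + 4 * ln (1 / weight e P)) \<le> (C P L)\<^sup>2" and "0 < C P L"
      by (simp_all add: C_def)
  qed
  have main: "\<exists>b. policy H b \<and>
        (\<forall>P. computable_distribution e P \<longrightarrow>
          0 < C P L \<and>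
          (\<forall>\<kappa> b_opt. conditional_distribution P \<kappa> \<longrightarrow> optimal_policy H loss \<kappa> b_opt \<longrightarrow>
            (\<forall>T \<ge> 1. \<forall>\<delta> \<in> {0<..<1}.
              measure P {\<omega> \<in> space P. regret loss b b_opt T \<omega> < C P L / sqrt (real T * \<delta>)}
                \<ge> 1 - \<delta>)))"
    if loss: "loss_function H L loss" and attained: "minimum_attained H loss"
    for H :: "'b measure" and L loss
  proof -
    define b where "b zs = (SOME b. is_arg_min (expected_loss loss (next_pmf (mixture e) zs))
      (\<lambda>b. b \<in> space H) b)" for zs
    have b: "is_arg_min (expected_loss loss (next_pmf (mixture e) zs)) (\<lambda>b. b \<in> space H) (b zs)" for zs
      unfolding b_def
    proof (rule someI_ex)
      \<comment> \<open>Every \<open>next_pmf\<close> is a probability measure, even after histories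
        that are impossible under the mixture, so a minimiser exists.\<close>
      show "\<exists>b. is_arg_min (expected_loss loss (next_pmf (mixture e) zs)) (\<lambda>b. b \<in> space H) b"
        using attained
        by (auto simp: minimum_attained_def space_prob_algebra measure_pmf.prob_space_axioms)
    qed
    then have b_H: "b zs \<in> space H" for zs by (simp add: is_arg_min_def)
    have bounds: "loss x z \<in> {0..L}" if "x \<in> space H" for x z
      using loss that by (auto simp: loss_function_def)
    have int: "integrable (measure_pmf p) (loss x)" if "x \<in> space H" for p x
      by (rule measure_pmf.integrable_const_bound[of _ L]) (use bounds[OF that] in auto)
    show ?thesis
    proof (intro exI[of _ b] conjI allI impI ballI)
      show "policy H b" using b_H by (simp add: policy_def)
      fix P assume P: "computable_distribution e P"
      show "0 < C P L" by (rule C_pos)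
      fix \<kappa> b_opt and T :: nat and \<delta> :: real
      assume \<kappa>: "conditional_distribution P \<kappa>" and opt: "optimal_policy H loss \<kappa> b_opt"
        and T: "1 \<le> T" and \<delta>: "\<delta> \<in> {0<..<1}"
      interpret SP: sequence_distribution P
        using P by unfold_locales (simp add: computable_distribution_def)
      interpret SU: sequence_distribution "mixture e"
        by unfold_locales (rule mixture_in_prob_algebra)
      have opt': "is_arg_min (expected_loss loss (\<kappa> zs)) (\<lambda>b. b \<in> space H) (b_opt zs)" for zs
        using opt by (simp add: optimal_policy_def)
      then have opt_H: "b_opt zs \<in> space H" for zs by (simp add: is_arg_min_def)
      interpret dominated_prediction P "mixture e" "weight e P" L
        "\<lambda>zs z. loss (b zs) z - loss (b_opt zs) z"
      proof unfold_locales
        show "0 < weight e P" by (rule weight_pos)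
        show "weight e P * cylinder_prob P zs \<le> cylinder_prob (mixture e) zs" for zs
          using P by (rule computable_dominated)
        show "\<bar>loss (b zs) z - loss (b_opt zs) z\<bar> \<le> L" for zs z
          using bounds[OF b_H, of zs z] bounds[OF opt_H, of zs z] by auto
        fix zs assume pos: "0 < cylinder_prob P zs"
        \<comment> \<open>On a history of positive probability \<open>\<kappa> zs\<close> is the
          prediction of \<open>P\<close>, whichever version is given, so \<open>b_opt zs\<close> is
          optimal for that prediction.\<close>
        show "0 \<le> (\<integral>z. loss (b zs) z - loss (b_opt zs) z \<partial>next_pmf P zs)"
          using opt'[of zs] b_H[of zs] opt_H[of zs] SP.conditional_distribution_unique[OF \<kappa> pos]
          by (simp add: int is_arg_min_def expected_loss_def not_less)
        show "(\<integral>z. loss (b zs) z - loss (b_opt zs) z \<partial>next_pmf (mixture e) zs) \<le> 0"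
          using b[of zs] b_H[of zs] opt_H[of zs]
          by (simp add: int is_arg_min_def expected_loss_def not_less)
      qed
      show "1 - \<delta> \<le> measure P {\<omega> \<in> space P. regret loss b b_opt T \<omega> < C P L / sqrt (real T * \<delta>)}"
        unfolding regret_def using \<delta> by (intro average_tail_bound T C_pos C_sq) auto
    qed
  qed
  show ?thesis using main by blast
qed

end
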